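(* Let $u\in\mathbb R^{\mathbb N}$ and $(h,\beta)\in\Gamma(u)$. The following statements hold (indices $j,k$ range over $\mathbb N$): 1. For all $j\ge K^s_u$, $K^s_u\le\mathfrak F_u(j,h,\beta)$. 2. Assume that $(h,\beta)\in\Gamma^{\mathrm{dec}}_{\mathrm{ev}}(u)$ and is usefully decreasing. Then: (a) for all $j\ge\mathfrak m(h,\beta)$, $K^s_u\le\mathfrak F_u(j,h,\beta)$; (b) if $K^s_u\ge\mathfrak m(h,\beta)$, then for all $j\in[\mathfrak m(h,\beta),K^s_u]$, $\mathfrak F_u(K^s_u,h,\beta)\le\mathfrak F_u(j,h,\beta)$. 3. If, moreover, $(h,\beta)\in\Gamma^{\mathrm{cst}}_{\mathrm{ev}}(u)$ (and is still usefully decreasing) and $K^s_u\ge\mathfrak c(h,\beta)$, then $$\min_{k\in\mathcal S(u,h)\cap[\mathfrak m(h,\beta),+\infty)}\mathfrak F_u(k,h,\beta)=\mathfrak F_u(K^s_u,h,\beta).$$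
   Context: $\mathbb N=\{0,1,2,\dots\}$. For $u=(u_k)_{k\in\mathbb N}\in\mathbb R^{\mathbb N}$: $\Delta^s_u:=\{k\in\mathbb N:\max_{0\le j\le k}u_j>\sup_{j>k}u_j\}$ and $K^s_u:=\inf\Delta^s_u$, with $\inf\emptyset=+\infty$. $\Omega([0,1])$ is the set of functions $f:\mathbb R\to\mathbb R$ strictly increasing and continuous on $[0,1]$; $f^{-1}:[f(0),f(1)]\to[0,1]$ denotes the inverse of $f$ restricted to $[0,1]$. $\Gamma(u):=\{(h,\beta)\in\Omega([0,1])^{\mathbb N}\times(0,1)^{\mathbb N}: u_k\le h_k(\beta_k^k)\ \forall k\in\mathbb N\}$, where $\beta_k^k$ is the $k$-th power of $\beta_k$. For $f,g\in\Omega([0,1])$, $f\le g$ means $f(x)\le g(x)$ for all $x\in[0,1]$; $(f,\beta)\le(g,\gamma)$ means $f\le g$ and $\beta\le\gamma$. $\Gamma^{\mathrm{dec}}_{\mathrm{ev}}(u)$ is the set of $(h,\beta)\in\Gamma(u)$ for which there is $N\in\mathbb N$ with $(h_{n+1},\beta_{n+1})\le(h_n,\beta_n)$ for all $n\ge N$; $\mathfrak m(h,\beta)$ is the smallest such $N$. $\Gamma^{\mathrm{cst}}_{\mathrm{ev}}(u)$ is the set of $(h,\beta)\in\Gamma(u)$ for which $((h_n,\beta_n))_n$ is constant from some index on; $\mathfrak c(h,\beta)$ is the smallest index from which it is constant. $\mathcal S(u,h):=\{k\in\mathbb N: u_k>h_k(0)\}$. $(h,\beta)\in\Gamma^{\mathrm{dec}}_{\mathrm{ev}}(u)$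 is usefully decreasing if $\mathcal S(u,h)\cap[\mathfrak m(h,\beta),+\infty)\neq\emptyset$. The upper bound functional is $\mathfrak F_u(k,h,\beta):=\ln(h_k^{-1}(u_k))/\ln(\beta_k)$ if $(h,\beta)\in\Gamma(u)$ and $u_k>h_k(0)$, and $+\infty$ otherwise. *)

theory Defs
  imports Complex_Main "HOL-Library.Extended_Real"
begin

definition Delta_s :: "(nat \<Rightarrow> real) \<Rightarrow> nat set" where
  "Delta_s u = {k. ereal (Max (u ` {0..k})) > (SUP j\<in>{k<..}. ereal (u j))}"

text \<open>The infimum is taken in \<open>enat\<close>, so that the empty set yields \<open>\<infinity>\<close>.\<close>

definition K_s :: "(nat \<Rightarrow> real) \<Rightarrow> enat" where
  "K_s u = Inf (enat ` Delta_s u)"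

definition Omega01 :: "(real \<Rightarrow> real) set" where
  "Omega01 = {f. strict_mono_on {0..1} f \<and> continuous_on {0..1} f}"

definition inv01 :: "(real \<Rightarrow> real) \<Rightarrow> real \<Rightarrow> real" where
  "inv01 f = inv_into {0..1} f"

definition Gamma :: "(nat \<Rightarrow> real) \<Rightarrow> ((nat \<Rightarrow> real \<Rightarrow> real) \<times> (nat \<Rightarrow> real)) set" where
  "Gamma u = {(h, \<beta>). (\<forall>k. h k \<in> Omega01) \<and> (\<forall>k. \<beta> k \<in> {0<..<1}) \<and>
                      (\<forall>k. u k \<le> h k (\<beta> k ^ k))}"

text \<open>Functions are compared on the unit interval only.\<close>

definition le01 :: "(real \<Rightarrow> real) \<Rightarrow> (real \<Rightarrow> real) \<Rightarrow> bool" where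
  "le01 f g \<longleftrightarrow> (\<forall>x\<in>{0..1}. f x \<le> g x)"

definition decreasing_from :: "(nat \<Rightarrow> real \<Rightarrow> real) \<Rightarrow> (nat \<Rightarrow> real) \<Rightarrow> nat \<Rightarrow> bool" where
  "decreasing_from h \<beta> N \<longleftrightarrow> (\<forall>n\<ge>N. le01 (h (Suc n)) (h n) \<and> \<beta> (Suc n) \<le> \<beta> n)"

definition Gamma_dec :: "(nat \<Rightarrow> real) \<Rightarrow> ((nat \<Rightarrow> real \<Rightarrow> real) \<times> (nat \<Rightarrow> real)) set" where
  "Gamma_dec u = {(h, \<beta>). (h, \<beta>) \<in> Gamma u \<and> (\<exists>N. decreasing_from h \<beta> N)}"

text \<open>The next index, like \<open>const_index\<close> below, is meaningful only when some index
  satisfies the condition.\<close>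

definition dec_index :: "(nat \<Rightarrow> real \<Rightarrow> real) \<Rightarrow> (nat \<Rightarrow> real) \<Rightarrow> nat" where
  "dec_index h \<beta> = (LEAST N. decreasing_from h \<beta> N)"

text \<open>Here the functions are compared as functions on the whole real line.\<close>

definition constant_from :: "(nat \<Rightarrow> real \<Rightarrow> real) \<Rightarrow> (nat \<Rightarrow> real) \<Rightarrow> nat \<Rightarrow> bool" where
  "constant_from h \<beta> N \<longleftrightarrow> (\<forall>n\<ge>N. h n = h N \<and> \<beta> n = \<beta> N)"

definition Gamma_cst :: "(nat \<Rightarrow> real) \<Rightarrow> ((nat \<Rightarrow> real \<Rightarrow> real) \<times> (nat \<Rightarrow> real)) set" where
  "Gamma_cst u = {(h, \<beta>). (h, \<beta>) \<in> Gamma u \<and> (\<exists>N. constant_from h \<beta> N)}"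

definition const_index :: "(nat \<Rightarrow> real \<Rightarrow> real) \<Rightarrow> (nat \<Rightarrow> real) \<Rightarrow> nat" where
  "const_index h \<beta> = (LEAST N. constant_from h \<beta> N)"

definition useful_set :: "(nat \<Rightarrow> real) \<Rightarrow> (nat \<Rightarrow> real \<Rightarrow> real) \<Rightarrow> nat set" where
  "useful_set u h = {k. u k > h k 0}"

definition usefully_decreasing ::
    "(nat \<Rightarrow> real) \<Rightarrow> (nat \<Rightarrow> real \<Rightarrow> real) \<Rightarrow> (nat \<Rightarrow> real) \<Rightarrow> bool" where
  "usefully_decreasing u h \<beta> \<longleftrightarrow>
     (h, \<beta>) \<in> Gamma_dec u \<and> useful_set u h \<inter> {dec_index h \<beta>..} \<noteq> {}"

definition upper_bound_functional ::
    "(nat \<Rightarrow> real) \<Rightarrow> nat \<Rightarrow> (nat \<Rightarrow> real \<Rightarrow> real) \<Rightarrow> (nat \<Rightarrow> real) \<Rightarrow> ereal" where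
  "upper_bound_functional u k h \<beta> =
     (if (h, \<beta>) \<in> Gamma u \<and> u k > h k 0
      then ereal (ln (inv01 (h k) (u k)) / ln (\<beta> k)) else \<infinity>)"

text \<open>Minimum of a possibly infinite set; in contrast to \<open>Inf\<close>, it has to be attained,
  and \<open>Min\<close> is specified for finite sets only.\<close>

definition is_minimum :: "'a::order set \<Rightarrow> 'a \<Rightarrow> bool" where
  "is_minimum A m \<longleftrightarrow> m \<in> A \<and> (\<forall>a\<in>A. m \<le> a)"

end

theory Submission
  imports Defs
begin

text \<open>Put \<open>x = inv01 (h k) (u k)\<close>. A bound \<open>u k \<le> h k (\<beta> k ^ n)\<close> forces \<open>x \<le> \<beta> k ^ n\<close>, that is,
  \<open>n \<le> ln x / ln (\<beta> k)\<close>; for \<open>n = k\<close> this is the definition of \<open>Gamma\<close>. If \<open>k < n \<le> K_s u\<close>, then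
  \<open>n - 1\<close> is not in \<open>Delta_s u\<close>, so \<open>u k\<close> is at most the supremum of the \<open>u i\<close> with \<open>i \<ge> n\<close>, and
  in the decreasing case each of these is at most \<open>h k (\<beta> k ^ n)\<close>. The optimality statements hold
  because \<open>u\<close> attains its maximum at \<open>K_s u\<close> and the functional increases when \<open>u k\<close> decreases
  and \<open>(h k, \<beta> k)\<close> increases.\<close>

section \<open>Inverses on the unit interval and the upper bound functional\<close>

lemma inv01_bounds:
  assumes "f \<in> Omega01" "f 0 < y" "y \<le> f b" "b \<in> {0..1}"
  shows "f (inv01 f y) = y" "0 < inv01 f y" "inv01 f y \<le> b"
proof -
  have mono: "strict_mono_on {0..1} f" and cont: "continuous_on {0..1} f"
    using assms(1) by (auto simp: Omega01_def)
  \<comment> \<open>Applying the intermediate value theorem on \<open>{0..b}\<close> yields a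
    preimage that is at most \<open>b\<close>; injectivity on \<open>{0..1}\<close> identifies it
    with \<open>inv01 f y\<close>.\<close>
  have "continuous_on {0..b} f"
    using cont assms(4) by (auto intro: continuous_on_subset)
  then obtain x where x: "0 \<le> x" "x \<le> b" "f x = y"
    using IVT'[of f 0 y b] assms by auto
  then have "inv01 f y = x"
    using inv_into_f_f[of f "{0..1}" x] mono assms(4)
    by (auto simp: inv01_def strict_mono_on_imp_inj_on)
  then show "f (inv01 f y) = y" "0 < inv01 f y" "inv01 f y \<le> b"
    using x assms(2) by (auto simp: less_le)
qed

lemma Omega01_le_iff:
  assumes "f \<in> Omega01" "x \<in> {0..1}" "y \<in> {0..1}"
  shows "f x \<le> f y \<longleftrightarrow> x \<le> y"
  using assms by (auto simp: Omega01_def strict_mono_on_less_eq)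

lemma Gamma_D:
  assumes "(h, \<beta>) \<in> Gamma u"
  shows "h k \<in> Omega01" "0 < \<beta> k" "\<beta> k < 1" "u k \<le> h k (\<beta> k ^ k)"
  using assms by (auto simp: Gamma_def)

text \<open>The exponent \<open>n\<close> is kept separate from the index \<open>k\<close>:
  \<open>Gamma\<close> supplies the hypothesis for \<open>n = k\<close>, and larger exponents come
  from decreasing pairs.\<close>

lemma upper_bound_functional_ge:
  assumes "(h, \<beta>) \<in> Gamma u" "u k \<le> h k (\<beta> k ^ n)"
  shows "ereal (real n) \<le> upper_bound_functional u k h \<beta>"
proof (cases "u k > h k 0")
  case True
  note G = Gamma_D[OF assms(1), of k]
  have "\<beta> k ^ n \<in> {0..1}"
    using G by (auto intro: power_le_one)
  from inv01_bounds[OF G(1) True assms(2) this]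
  have "ln (inv01 (h k) (u k)) \<le> ln (\<beta> k ^ n)"
    using G by (subst ln_le_cancel_iff) auto
  then have "ln (inv01 (h k) (u k)) \<le> real n * ln (\<beta> k)"
    using G by (simp add: ln_realpow)
  \<comment> \<open>The divisor \<open>ln (\<beta> k)\<close> is negative, so the inequality is
    reversed.\<close>
  then have "real n \<le> ln (inv01 (h k) (u k)) / ln (\<beta> k)"
    using G by (simp add: neg_le_divide_eq)
  then show ?thesis
    using True assms(1) by (simp add: upper_bound_functional_def)
qed (simp add: upper_bound_functional_def)

text \<open>A lower function reaches a higher value only further to the right. So the numerator's
  logarithm moves towards zero, while a smaller \<open>\<beta>\<close> gives a denominator of larger
  absolute value.\<close>

lemma upper_bound_functional_antimono:
  assumes "(h, \<beta>) \<in> Gamma u" "le01 (h k) (h j)" "\<beta> k \<le> \<beta> j" "u j \<le> u k"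
  shows "upper_bound_functional u k h \<beta> \<le> upper_bound_functional u j h \<beta>"
\<comment> \<open>If this fails, the right-hand side is infinite. Otherwise
  \<open>h k 0 \<le> h j 0 < u j \<le> u k\<close>, so both sides are real quotients.\<close>
proof (cases "u j > h j 0")
  case j: True
  then have k: "u k > h k 0"
    using assms(2,4) by (force simp: le01_def)
  note G = Gamma_D[OF assms(1)]
  have pow: "\<beta> i ^ i \<in> {0..1}" for i
    using G[of i] by (auto intro: power_le_one)
  define x where "x i = inv01 (h i) (u i)" for i
  have xj: "h j (x j) = u j" "0 < x j" "x j \<le> 1"
    and xk: "h k (x k) = u k" "0 < x k" "x k \<le> 1"
    using inv01_bounds[OF G(1) j G(4) pow] inv01_bounds[OF G(1) k G(4) pow] pow[of j] pow[of k]
    by (auto simp: x_def)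
  have "h k (x k) \<le> h j (x k)"
    using assms(2) xk(2,3) by (simp add: le01_def)
  then have "h j (x j) \<le> h j (x k)"
    using xj(1) xk(1) assms(4) by linarith
  then have "x j \<le> x k"
    using Omega01_le_iff[OF G(1), of "x j" "x k" j] xj(2,3) xk(2,3) by simp
  \<comment> \<open>Negating all logarithms makes numerators nonnegative and denominators positive,
    as \<open>frac_le\<close> requires.\<close>
  then have "- ln (x k) \<le> - ln (x j)"
    using xj xk by simp
  moreover have "- ln (\<beta> j) \<le> - ln (\<beta> k)"
    using G(2) assms(3) by simp
  ultimately have "- ln (x k) / - ln (\<beta> k) \<le> - ln (x j) / - ln (\<beta> j)"
    using G(2,3) xj(2,3) by (intro frac_le) auto
  then show ?thesis
    using j k assms(1) by (simp add: upper_bound_functional_def x_def)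
qed (simp add: upper_bound_functional_def)

section \<open>\<open>K_s u\<close> and the maximum of the sequence\<close>

lemma le_SUP_of_le_K_s:
  assumes "enat n \<le> K_s u" "j < n"
  shows "ereal (u j) \<le> (SUP i\<in>{n..}. ereal (u i))"
proof -
  \<comment> \<open>Since \<open>j < n\<close> excludes \<open>n = 0\<close>, the subtraction is not
    truncated and \<open>n - 1\<close> lies strictly below \<open>K_s u\<close>.\<close>
  have "n - 1 \<notin> Delta_s u"
  proof
    assume "n - 1 \<in> Delta_s u"
    then have "K_s u \<le> enat (n - 1)"
      unfolding K_s_def by (intro Inf_lower) auto
    with assms(1) have "enat n \<le> enat (n - 1)"
      by (rule order_trans)
    with assms(2) show False by simp
  qed
  moreover have "{n - 1<..} = {n..}"
    using assms(2) by auto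
  ultimately have "ereal (Max (u ` {0..n - 1})) \<le> (SUP i\<in>{n..}. ereal (u i))"
    by (simp add: Delta_s_def not_less)
  moreover have "u j \<le> Max (u ` {0..n - 1})"
    using assms(2) by (intro Max_ge) auto
  ultimately show ?thesis
    by (meson ereal_less_eq(3) order_trans)
qed

text \<open>A finite infimum in \<open>enat\<close> comes from a nonempty set, and there it is
  attained.\<close>

lemma K_s_in_Delta_s:
  assumes "K_s u = enat K"
  shows "K \<in> Delta_s u"
proof -
  have "enat ` Delta_s u \<noteq> {}"
    using assms by (auto simp: K_s_def Inf_enat_def)
  then have "Inf (enat ` Delta_s u) \<in> enat ` Delta_s u"
    by (auto simp: Inf_enat_def intro: LeastI)
  then show ?thesis
    using assms by (auto simp: K_s_def)
qed

text \<open>The maximum over \<open>{0..K}\<close> strictly exceeds the supremum of all later terms.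
  If it is attained at some \<open>i < K\<close>, minimality of \<open>K\<close> bounds it by the
  supremum from \<open>K\<close> on, and only the term \<open>u K\<close> can reach it.\<close>

lemma K_s_maximizes:
  assumes "K_s u = enat K"
  shows "u j \<le> u K"
proof -
  have Max: "(SUP j\<in>{K<..}. ereal (u j)) < ereal (Max (u ` {0..K}))"
    using K_s_in_Delta_s[OF assms] by (simp add: Delta_s_def)
  have "Max (u ` {0..K}) \<in> u ` {0..K}"
    by (intro Max_in) auto
  then obtain i where i: "i \<le> K" "Max (u ` {0..K}) = u i"
    by (meson atLeastAtMost_iff imageE)
  have "u i \<le> u K"
  proof (cases "i = K")
    case False
    then have "ereal (u i) \<le> (SUP l\<in>{K..}. ereal (u l))"
      using i assms by (intro le_SUP_of_le_K_s) auto
    also have "{K..} = insert K {K<..}"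
      by auto
    also have "(SUP l\<in>insert K {K<..}. ereal (u l)) = max (ereal (u K)) (SUP l\<in>{K<..}. ereal (u l))"
      by (simp add: sup_max)
    finally show ?thesis
      using Max i(2) by (auto simp: le_max_iff_disj)
  qed simp
  moreover have "u j \<le> u i"
  proof (cases "j \<le> K")
    case True
    then have "u j \<le> Max (u ` {0..K})"
      by (intro Max_ge) auto
    with i show ?thesis by simp
  next
    case False
    then have "ereal (u j) \<le> (SUP j\<in>{K<..}. ereal (u j))"
      by (intro SUP_upper) auto
    then show ?thesis
      using Max i(2) by (metis ereal_less_eq(3) less_imp_le order_trans)
  qed
  ultimately show ?thesis by simp
qed

section \<open>Eventually decreasing and eventually constant pairs\<close>

lemma decreasing_from_mono:
  assumes "decreasing_from h \<beta> N" "N \<le> m" "m \<le> n"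
  shows "le01 (h n) (h m) \<and> \<beta> n \<le> \<beta> m"
  using assms(3)
proof (induction rule: dec_induct)
  case base
  then show ?case by (simp add: le01_def)
next
  case (step n)
  with assms have "le01 (h (Suc n)) (h n)" "\<beta> (Suc n) \<le> \<beta> n"
    by (auto simp: decreasing_from_def)
  with step.IH show ?case
    by (force simp: le01_def)
qed

lemma decreasing_from_dec_index:
  assumes "(h, \<beta>) \<in> Gamma_dec u"
  shows "decreasing_from h \<beta> (dec_index h \<beta>)"
  using assms by (auto simp: Gamma_dec_def dec_index_def intro: LeastI)

lemma constant_from_const_index:
  assumes "(h, \<beta>) \<in> Gamma_cst u"
  shows "constant_from h \<beta> (const_index h \<beta>)"
  using assms by (auto simp: Gamma_cst_def const_index_def intro: LeastI)

lemma dec_index_le_const_index: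
  assumes "(h, \<beta>) \<in> Gamma_cst u"
  shows "dec_index h \<beta> \<le> const_index h \<beta>"
proof -
  have "h (Suc n) = h n \<and> \<beta> (Suc n) = \<beta> n" if "n \<ge> const_index h \<beta>" for n
    using constant_from_const_index[OF assms] that unfolding constant_from_def by (metis le_SucI)
  then have "decreasing_from h \<beta> (const_index h \<beta>)"
    by (simp add: decreasing_from_def le01_def)
  then show ?thesis
    unfolding dec_index_def by (rule Least_le)
qed

section \<open>Bounds on \<open>K_s u\<close> and optimality at \<open>K_s u\<close>\<close>

lemma ereal_of_enat_leI:
  assumes "\<And>n. enat n \<le> N \<Longrightarrow> ereal (real n) \<le> x"
  shows "ereal_of_enat N \<le> x"
proof (cases N)
  case (enat n)
  then show ?thesis using assms by simp
next
  case infinity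
  \<comment> \<open>Here \<open>x\<close> dominates every natural number, hence every real.\<close>
  then have "x = \<infinity>"
    using assms by (intro ereal_top) (metis enat_ord_simps(3) ereal_less_eq(3) order_trans real_arch_simple)
  then show ?thesis by simp
qed

lemma K_s_le_upper_bound_functional:
  assumes "(h, \<beta>) \<in> Gamma u" "decreasing_from h \<beta> N" "N \<le> j"
  shows "ereal_of_enat (K_s u) \<le> upper_bound_functional u j h \<beta>"
proof (intro ereal_of_enat_leI upper_bound_functional_ge[OF assms(1)])
  fix n assume n: "enat n \<le> K_s u"
  note G = Gamma_D[OF assms(1)]
  have pow: "\<beta> i ^ k \<in> {0..1}" for i k
    using G(2,3)[of i] by (auto intro: power_le_one)
  \<comment> \<open>This bound does not depend on \<open>i\<close>, so it passes to the supremum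
    over \<open>i \<ge> n\<close>.\<close>
  have *: "u i \<le> h j (\<beta> j ^ n)" if "j \<le> i" "n \<le> i" for i
  proof -
    note dec = decreasing_from_mono[OF assms(2,3) that(1)]
    have "\<beta> i ^ i \<le> \<beta> j ^ i"
      using dec G(2) by (intro power_mono) (auto intro: less_imp_le)
    also have "\<dots> \<le> \<beta> j ^ n"
      using that(2) G(2,3) by (intro power_decreasing) (auto intro: less_imp_le)
    finally have "h j (\<beta> i ^ i) \<le> h j (\<beta> j ^ n)"
      using Omega01_le_iff[OF G(1) pow pow] by blast
    then show ?thesis
      using G(4)[of i] dec pow[of i i] unfolding le01_def by (meson order_trans)
  qed
  show "u j \<le> h j (\<beta> j ^ n)"
  \<comment> \<open>For \<open>n \<le> j\<close> the bound \<open>*\<close> applies to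
    \<open>i = j\<close>; otherwise \<open>u j\<close> is controlled through the terms from
    \<open>n\<close> on.\<close>
  proof (cases "n \<le> j")
    case False
    then have "ereal (u j) \<le> (SUP i\<in>{n..}. ereal (u i))"
      by (intro le_SUP_of_le_K_s n) auto
    also have "\<dots> \<le> ereal (h j (\<beta> j ^ n))"
      using * False by (intro SUP_least) auto
    finally show ?thesis by simp
  qed (use * in auto)
qed

text \<open>At a useful index the functional is a real number, and it bounds \<open>K_s u\<close>
  from above.\<close>

lemma K_s_finite:
  assumes "usefully_decreasing u h \<beta>"
  obtains K where "K_s u = enat K"
proof -
  from assms have dec: "(h, \<beta>) \<in> Gamma_dec u" and G: "(h, \<beta>) \<in> Gamma u"
    by (auto simp: usefully_decreasing_def Gamma_dec_def)
  obtain k where k: "k \<ge> dec_index h \<beta>" "u k > h k 0"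
    using assms by (auto simp: usefully_decreasing_def useful_set_def)
  have "ereal_of_enat (K_s u) \<le> upper_bound_functional u k h \<beta>"
    using K_s_le_upper_bound_functional[OF G decreasing_from_dec_index[OF dec] k(1)] .
  moreover have "upper_bound_functional u k h \<beta> \<noteq> \<infinity>"
    using k(2) G by (simp add: upper_bound_functional_def)
  ultimately have "K_s u \<noteq> \<infinity>"
    by (metis ereal_infty_less_eq(1) ereal_of_enat_simps(2))
  then show ?thesis
    using that by auto
qed

lemma upper_bound_functional_K_s_le:
  assumes "(h, \<beta>) \<in> Gamma u" "K_s u = enat K" "decreasing_from h \<beta> N" "j \<in> {N..K}"
  shows "upper_bound_functional u K h \<beta> \<le> upper_bound_functional u j h \<beta>"
  using assms(4) decreasing_from_mono[OF assms(3), of j K] K_s_maximizes[OF assms(2)]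
  by (intro upper_bound_functional_antimono assms(1)) auto

text \<open>Up to \<open>K\<close> the pairs decrease; after \<open>K\<close> they no longer change,
  and maximality of \<open>u K\<close> alone decides the comparison.\<close>

lemma upper_bound_functional_K_s_is_minimum:
  assumes "usefully_decreasing u h \<beta>" "(h, \<beta>) \<in> Gamma_cst u"
    and K: "K_s u = enat K" "const_index h \<beta> \<le> K"
  shows "is_minimum ((\<lambda>k. upper_bound_functional u k h \<beta>) ` (useful_set u h \<inter> {dec_index h \<beta>..}))
           (upper_bound_functional u K h \<beta>)"
proof -
  from assms have dec: "(h, \<beta>) \<in> Gamma_dec u" and G: "(h, \<beta>) \<in> Gamma u"
    by (auto simp: usefully_decreasing_def Gamma_dec_def)
  have le: "upper_bound_functional u K h \<beta> \<le> upper_bound_functional u j h \<beta>"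
    if "dec_index h \<beta> \<le> j" for j
  proof (cases "j \<le> K")
    case True
    with that show ?thesis
      by (intro upper_bound_functional_K_s_le[OF G K(1) decreasing_from_dec_index[OF dec]]) auto
  next
    case False
    then have "h j = h K" "\<beta> j = \<beta> K"
      using constant_from_const_index[OF assms(2)] K(2)
      unfolding constant_from_def by (metis nat_le_linear order_trans)+
    then show ?thesis
      using K_s_maximizes[OF K(1)] by (intro upper_bound_functional_antimono G) (auto simp: le01_def)
  qed
  obtain k where k: "k \<ge> dec_index h \<beta>" "u k > h k 0"
    using assms(1) by (auto simp: usefully_decreasing_def useful_set_def)
  from k(2) G have "upper_bound_functional u k h \<beta> \<noteq> \<infinity>"
    by (simp add: upper_bound_functional_def)
  \<comment> \<open>Finiteness passes from the useful index \<open>k\<close> to \<open>K\<close>,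
    which makes \<open>K\<close> useful, so the minimum is attained inside the set.\<close>
  with le[OF k(1)] have "upper_bound_functional u K h \<beta> \<noteq> \<infinity>"
    by auto
  then have "K \<in> useful_set u h"
    by (auto simp: upper_bound_functional_def useful_set_def split: if_splits)
  moreover have "dec_index h \<beta> \<le> K"
    using dec_index_le_const_index[OF assms(2)] K(2) by simp
  ultimately show ?thesis
    using le by (auto simp: is_minimum_def)
qed

theorem proposition9:
  fixes u :: "nat \<Rightarrow> real" and h :: "nat \<Rightarrow> real \<Rightarrow> real" and \<beta> :: "nat \<Rightarrow> real"
  assumes "(h, \<beta>) \<in> Gamma u"
  shows
    "(\<forall>j. enat j \<ge> K_s u \<longrightarrow> ereal_of_enat (K_s u) \<le> upper_bound_functional u j h \<beta>)
     \<and> ((h, \<beta>) \<in> Gamma_dec u \<and> usefully_decreasing u h \<beta> \<longrightarrow>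
          (\<forall>j\<ge>dec_index h \<beta>. ereal_of_enat (K_s u) \<le> upper_bound_functional u j h \<beta>)
        \<and> (K_s u \<ge> enat (dec_index h \<beta>) \<longrightarrow>
            (\<exists>K. K_s u = enat K \<and>
              (\<forall>j\<in>{dec_index h \<beta>..K}.
                 upper_bound_functional u K h \<beta> \<le> upper_bound_functional u j h \<beta>))))
     \<and> ((h, \<beta>) \<in> Gamma_dec u \<and> usefully_decreasing u h \<beta> \<and> (h, \<beta>) \<in> Gamma_cst u
          \<and> K_s u \<ge> enat (const_index h \<beta>) \<longrightarrow>
          (\<exists>K. K_s u = enat K \<and>
             is_minimum ((\<lambda>k. upper_bound_functional u k h \<beta>) ` (useful_set u h \<inter> {dec_index h \<beta>..}))
               (upper_bound_functional u K h \<beta>)))"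
proof (intro conjI impI allI)
  fix j assume "enat j \<ge> K_s u"
  \<comment> \<open>The comparison passes through \<open>j\<close> itself, which is below the
    functional by the \<open>Gamma\<close> bound with exponent \<open>j\<close>.\<close>
  then have "ereal_of_enat (K_s u) \<le> ereal (real j)"
    by (metis ereal_of_enat_le_iff ereal_of_enat_simps(1))
  also have "\<dots> \<le> upper_bound_functional u j h \<beta>"
    by (rule upper_bound_functional_ge[OF assms Gamma_D(4)[OF assms]])
  finally show "ereal_of_enat (K_s u) \<le> upper_bound_functional u j h \<beta>" .
next
  fix j assume "(h, \<beta>) \<in> Gamma_dec u \<and> usefully_decreasing u h \<beta>" "dec_index h \<beta> \<le> j"
  then show "ereal_of_enat (K_s u) \<le> upper_bound_functional u j h \<beta>"
    using K_s_le_upper_bound_functional[OF assms decreasing_from_dec_index] by blast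
next
  assume "(h, \<beta>) \<in> Gamma_dec u \<and> usefully_decreasing u h \<beta>"
  then show "\<exists>K. K_s u = enat K \<and>
              (\<forall>j\<in>{dec_index h \<beta>..K}.
                 upper_bound_functional u K h \<beta> \<le> upper_bound_functional u j h \<beta>)"
    using K_s_finite upper_bound_functional_K_s_le[OF assms _ decreasing_from_dec_index] by metis
next
  assume *: "(h, \<beta>) \<in> Gamma_dec u \<and> usefully_decreasing u h \<beta> \<and> (h, \<beta>) \<in> Gamma_cst u
          \<and> K_s u \<ge> enat (const_index h \<beta>)"
  then obtain K where K: "K_s u = enat K"
    using K_s_finite by blast
  with * have "const_index h \<beta> \<le> K"
    by simp
  with K * show "\<exists>K. K_s u = enat K \<and>
             is_minimum ((\<lambda>k. upper_bound_functional u k h \<beta>) ` (useful_set u h \<inter> {dec_index h \<beta>..}))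
               (upper_bound_functional u K h \<beta>)"
    using upper_bound_functional_K_s_is_minimum by blast
qed

end
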